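(* Let $M$ be a Kähler manifold of complex dimension $n\ge 2$ with Kähler form $\omega$, let $\Omega\subset M$ be a domain and let $v\in C^2(\Omega)$. Then $v$ is $2$-harmonic if and only if $v$ is pluriharmonic.
   Context: A real-valued function $v\in C^2(\Omega)$ is $m$-harmonic (with respect to $\omega$) if $(dd^c v)^k\wedge\omega^{n-k}=0$ on $\Omega$ for every $k=1,2,\dots,m$; in particular $2$-harmonic means that this holds for $k=1$ and $k=2$. The function $v$ is pluriharmonic if $dd^c v=0$. Here, in local holomorphic coordinates, $dd^c v=\frac{i}{2}\sum_{k,l}\frac{\partial^2 v}{\partial z_k\partial\bar z_l}\,dz_k\wedge d\bar z_l$. *)

theory Defs
  imports "HOL-Analysis.Analysis" "HOL-Combinatorics.Permutations"
begin

section \<open>Calculus on open subsets of complex coordinate space\<close>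

text \<open>Only meant for open \<open>S\<close>.\<close>

primrec C_k_on :: "nat \<Rightarrow> 'a::real_normed_vector set \<Rightarrow> ('a \<Rightarrow> 'b::real_normed_vector) \<Rightarrow> bool" where
  "C_k_on 0 S f \<longleftrightarrow> continuous_on S f"
| "C_k_on (Suc k) S f \<longleftrightarrow>
     (\<forall>x\<in>S. f differentiable (at x)) \<and>
     (\<forall>a. C_k_on k S (\<lambda>x. frechet_derivative f (at x) a))"

definition smooth_on :: "'a::real_normed_vector set \<Rightarrow> ('a \<Rightarrow> 'b::real_normed_vector) \<Rightarrow> bool" where
  "smooth_on S f \<longleftrightarrow> (\<forall>k. C_k_on k S f)"

definition holomorphic_map_on :: "(complex^'n) set \<Rightarrow> (complex^'n \<Rightarrow> complex^'n::finite) \<Rightarrow> bool" where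
  "holomorphic_map_on S f \<longleftrightarrow>
     (\<forall>z\<in>S. \<exists>D. (f has_derivative D) (at z) \<and> (\<forall>c x. D (c *s x) = c *s D x))"

definition wirtinger :: "'n \<Rightarrow> (complex^'n \<Rightarrow> complex) \<Rightarrow> complex^'n::finite \<Rightarrow> complex" where
  "wirtinger k f z =
     (frechet_derivative f (at z) (axis k 1) - \<i> * frechet_derivative f (at z) (axis k \<i>)) / 2"

definition wirtinger_bar :: "'n \<Rightarrow> (complex^'n \<Rightarrow> complex) \<Rightarrow> complex^'n::finite \<Rightarrow> complex" where
  "wirtinger_bar k f z =
     (frechet_derivative f (at z) (axis k 1) + \<i> * frechet_derivative f (at z) (axis k \<i>)) / 2"


section \<open>Differential forms in coordinates\<close>

text \<open>
  A complex-valued \<open>p\<close>-form at a point is a function of a sequence of tangent vectors of which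
  only the entries with index \<open>< p\<close> matter. The degree is not part of the type, so the operations
  below take it as an argument. The real tangent space of the coordinate space is
  \<open>complex^'n\<close> itself.
\<close>

type_synonym 'n form = "(nat \<Rightarrow> complex^'n) \<Rightarrow> complex"

text \<open>Determinant convention, i.e. \<open>(a \<and> b)(X, Y) = a(X) b(Y) - a(Y) b(X)\<close> for 1-forms.\<close>

definition wedge :: "nat \<Rightarrow> nat \<Rightarrow> 'n form \<Rightarrow> 'n form \<Rightarrow> ('n::finite) form" where
  "wedge p q a b = (\<lambda>X.
     (\<Sum>\<sigma> | \<sigma> permutes {..<p + q}.
        of_int (sign \<sigma>) * a (\<lambda>i. X (\<sigma> i)) * b (\<lambda>i. X (\<sigma> (p + i))))
     / (fact p * fact q))"

primrec wedge_power :: "nat \<Rightarrow> 'n form \<Rightarrow> nat \<Rightarrow> ('n::finite) form" where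
  "wedge_power p a 0 = (\<lambda>X. 1)"
| "wedge_power p a (Suc k) = wedge p (k * p) a (wedge_power p a k)"

definition dz :: "'n \<Rightarrow> ('n::finite) form" where
  "dz k = (\<lambda>X. X 0 $ k)"

definition dz_bar :: "'n \<Rightarrow> ('n::finite) form" where
  "dz_bar k = (\<lambda>X. cnj (X 0 $ k))"

definition form11 :: "complex^'n^'n \<Rightarrow> ('n::finite) form" where
  "form11 H = (\<lambda>X. \<i> / 2 * (\<Sum>k\<in>UNIV. \<Sum>l\<in>UNIV. H $ k $ l * wedge 1 1 (dz k) (dz_bar l) X))"

text \<open>
  The summand for \<open>i\<close> differentiates, in direction \<open>X i\<close>, the value of the form on the
  remaining vectors (regarded as constant vector fields).
\<close>

definition ext_deriv :: "nat \<Rightarrow> (complex^'n \<Rightarrow> 'n form) \<Rightarrow> complex^'n \<Rightarrow> ('n::finite) form" where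
  "ext_deriv p a z = (\<lambda>X.
     \<Sum>i\<le>p. (-1) ^ i *
       frechet_derivative (\<lambda>w. a w (\<lambda>j. X (if j < i then j else Suc j))) (at z) (X i))"

definition pullback :: "(complex^'n \<Rightarrow> complex^'n) \<Rightarrow> (complex^'n \<Rightarrow> 'n form) \<Rightarrow> complex^'n \<Rightarrow> ('n::finite) form" where
  "pullback f a z = (\<lambda>X. a (f z) (\<lambda>i. frechet_derivative f (at z) (X i)))"

definition ddc_coord :: "(complex^'n \<Rightarrow> real) \<Rightarrow> complex^'n \<Rightarrow> ('n::finite) form" where
  "ddc_coord u z =
     form11 (\<chi> k l. wirtinger k (wirtinger_bar l (\<lambda>w. complex_of_real (u w))) z)"


section \<open>Complex manifolds and Kaehler forms\<close>

type_synonym ('m, 'n) chart = "'m set \<times> ('m \<Rightarrow> complex^'n)"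

definition chart_inv :: "('m, 'n::finite) chart \<Rightarrow> complex^'n \<Rightarrow> 'm" where
  "chart_inv c = inv_into (fst c) (snd c)"

definition transition :: "('m, 'n) chart \<Rightarrow> ('m, 'n) chart \<Rightarrow> complex^'n \<Rightarrow> complex^'n::finite" where
  "transition c c' = (\<lambda>z. snd c' (chart_inv c z))"

locale complex_manifold =
  fixes M :: "'m topology" and \<A> :: "('m, 'n::finite) chart set"
  assumes Hausdorff: "Hausdorff_space M"
    and second_countable: "second_countable M"
    and cover: "(\<Union>c\<in>\<A>. fst c) = topspace M"
    and chart_domain: "c \<in> \<A> \<Longrightarrow> openin M (fst c)"
    and chart_image: "c \<in> \<A> \<Longrightarrow> open (snd c ` fst c)"
    and chart_homeo: "c \<in> \<A> \<Longrightarrow>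
      homeomorphic_map (subtopology M (fst c)) (top_of_set (snd c ` fst c)) (snd c)"
    and transition_holomorphic: "c \<in> \<A> \<Longrightarrow> c' \<in> \<A> \<Longrightarrow>
      holomorphic_map_on (snd c ` (fst c \<inter> fst c')) (transition c c')"

text \<open>
  A differential form on the manifold is given by its coordinate expressions: \<open>\<omega> c z\<close> is the form
  at the point with coordinates \<open>z\<close> in the chart \<open>c\<close>, and these expressions are related by
  pullback along the transition maps.
\<close>

locale kaehler_manifold = complex_manifold M \<A>
  for M :: "'m topology" and \<A> :: "('m, 'n::finite) chart set" +
  fixes \<omega> :: "('m, 'n) chart \<Rightarrow> complex^'n \<Rightarrow> 'n form"
  assumes compatible: "c \<in> \<A> \<Longrightarrow> c' \<in> \<A> \<Longrightarrow> z \<in> snd c ` (fst c \<inter> fst c') \<Longrightarrow>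
      \<omega> c z = pullback (transition c c') (\<omega> c') z"
    and hermitian_metric: "c \<in> \<A> \<Longrightarrow>
      \<exists>g. smooth_on (snd c ` fst c) g \<and>
        (\<forall>z \<in> snd c ` fst c.
          (\<forall>k l. g z $ l $ k = cnj (g z $ k $ l)) \<and>
          (\<forall>x. x \<noteq> 0 \<longrightarrow> Re (\<Sum>k\<in>UNIV. \<Sum>l\<in>UNIV. g z $ k $ l * x $ k * cnj (x $ l)) > 0) \<and>
          \<omega> c z = form11 (g z))"
    and closed: "c \<in> \<A> \<Longrightarrow> z \<in> snd c ` fst c \<Longrightarrow> ext_deriv 2 (\<omega> c) z = (\<lambda>X. 0)"


section \<open>Functions on complex manifolds\<close>

definition C_k_function :: "nat \<Rightarrow> ('m, 'n::finite) chart set \<Rightarrow> 'm set \<Rightarrow> ('m \<Rightarrow> real) \<Rightarrow> bool" where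
  "C_k_function k \<A> \<Omega> v \<longleftrightarrow>
     (\<forall>c\<in>\<A>. C_k_on k (snd c ` (fst c \<inter> \<Omega>)) (\<lambda>z. v (chart_inv c z)))"

definition ddc :: "('m \<Rightarrow> real) \<Rightarrow> ('m, 'n) chart \<Rightarrow> complex^'n \<Rightarrow> ('n::finite) form" where
  "ddc v c = ddc_coord (\<lambda>z. v (chart_inv c z))"

definition vanishes_on ::
  "('m, 'n::finite) chart set \<Rightarrow> 'm set \<Rightarrow> (('m, 'n) chart \<Rightarrow> complex^'n \<Rightarrow> 'n form) \<Rightarrow> bool" where
  "vanishes_on \<A> \<Omega> a \<longleftrightarrow> (\<forall>c\<in>\<A>. \<forall>z \<in> snd c ` (fst c \<inter> \<Omega>). a c z = (\<lambda>X. 0))"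

text \<open>Meant for \<open>m \<le> CARD('n)\<close>, where the exponent of \<open>\<omega>\<close> does not truncate.\<close>

definition m_harmonic ::
  "nat \<Rightarrow> ('m, 'n::finite) chart set \<Rightarrow> (('m, 'n) chart \<Rightarrow> complex^'n \<Rightarrow> 'n form) \<Rightarrow> 'm set \<Rightarrow> ('m \<Rightarrow> real) \<Rightarrow> bool" where
  "m_harmonic m \<A> \<omega> \<Omega> v \<longleftrightarrow>
     (\<forall>k\<in>{1..m}. vanishes_on \<A> \<Omega> (\<lambda>c z.
        wedge (k * 2) ((CARD('n) - k) * 2)
          (wedge_power 2 (ddc v c z) k) (wedge_power 2 (\<omega> c z) (CARD('n) - k))))"

definition pluriharmonic :: "('m, 'n::finite) chart set \<Rightarrow> 'm set \<Rightarrow> ('m \<Rightarrow> real) \<Rightarrow> bool" where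
  "pluriharmonic \<A> \<Omega> v \<longleftrightarrow> vanishes_on \<A> \<Omega> (ddc v)"

end

theory Submission
  imports Defs
begin

text \<open>
  The theorem is linear algebra at each point. In a chart, \<open>\<omega>\<close> is the (1,1)-form of a positive
  definite Hermitian matrix \<open>G\<close>, and \<open>dd\<^sup>c v\<close> is the (1,1)-form of the complex Hessian \<open>H\<close> of \<open>v\<close>,
  which is Hermitian because the second derivatives of a \<open>C\<^sup>2\<close> function commute
  (\<open>hermitian_complex_hessian\<close>). The two Hermitian forms are diagonal in a common basis
  \<open>e\<^sub>0, \<dots>, e\<^bsub>n-1\<^esub>\<close> of the coordinate space, orthonormal for \<open>G\<close> and with real values \<open>\<mu>\<^sub>j = H(e\<^sub>j, e\<^sub>j)\<close>
  (\<open>simultaneous_diagonalisation\<close>). On the real frame \<open>e\<^sub>0, i e\<^sub>0, e\<^sub>1, i e\<^sub>1, \<dots>\<close> both 2-forms are then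
  block diagonal with blocks of size two, and

    \<open>(dd\<^sup>c v \<and> \<omega>\<^bsup>n-1\<^esup>)(e\<^sub>0, i e\<^sub>0, \<dots>) = (n-1)! \<Sum>\<^sub>j \<mu>\<^sub>j\<close>,

    \<open>((dd\<^sup>c v)\<^sup>2 \<and> \<omega>\<^bsup>n-2\<^esup>)(e\<^sub>0, i e\<^sub>0, \<dots>) = (n-2)! ((\<Sum>\<^sub>j \<mu>\<^sub>j)\<^sup>2 - \<Sum>\<^sub>j \<mu>\<^sub>j\<^sup>2)\<close>.

  If both vanish, then \<open>\<Sum>\<^sub>j \<mu>\<^sub>j\<^sup>2 = 0\<close>, so every \<open>\<mu>\<^sub>j\<close> is zero and hence \<open>H = 0\<close>. The converse holds because
  a wedge product with the zero form is zero.

  The two evaluations rest on \<open>wedge_block_diagonal\<close>, which expands a wedge product whose first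
  factor is a block diagonal 2-form. It applies to one such factor at a time, and associativity
  of the wedge product (\<open>wedge_assoc\<close>) splits the square of \<open>dd\<^sup>c v\<close> into two factors.
\<close>

section \<open>Permutations and wedge products\<close>

text \<open>
  Antisymmetry alone: independence of the vectors with index \<open>\<ge> q\<close> is not included.
\<close>

definition alternating :: "nat \<Rightarrow> ('n::finite) form \<Rightarrow> bool" where
  "alternating q b \<longleftrightarrow>
     (\<forall>X \<rho>. \<rho> permutes {..<q} \<longrightarrow> b (\<lambda>i. X (\<rho> i)) = of_int (sign \<rho>) * b X)"

lemma alternatingD:
  "alternating q b \<Longrightarrow> \<rho> permutes {..<q} \<Longrightarrow> b (\<lambda>i. X (\<rho> i)) = of_int (sign \<rho>) * b X"
  by (simp add: alternating_def)

lemma sign_compose_permutes: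
  "p permutes S \<Longrightarrow> q permutes S \<Longrightarrow> finite S \<Longrightarrow> sign (p \<circ> q) = sign p * sign q"
  by (meson permutation_permutes sign_compose)

text \<open>
  Permuting the vectors by \<open>\<rho>\<close> turns the summand of \<open>\<sigma>\<close> into that of \<open>\<rho> \<circ> \<sigma>\<close> up to the sign of \<open>\<rho>\<close>.
\<close>

lemma alternating_wedge: "alternating (p + q) (wedge p q a b)"
  unfolding alternating_def
proof (intro allI impI)
  fix X :: "nat \<Rightarrow> complex^'a" and \<rho>
  assume \<rho>: "\<rho> permutes {..<p + q}"
  have "(\<Sum>\<sigma> | \<sigma> permutes {..<p + q}.
          of_int (sign \<sigma>) * a (\<lambda>i. X (\<sigma> i)) * b (\<lambda>i. X (\<sigma> (p + i))))
      = (\<Sum>\<sigma> | \<sigma> permutes {..<p + q}.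
          of_int (sign (\<rho> \<circ> \<sigma>)) * a (\<lambda>i. X ((\<rho> \<circ> \<sigma>) i)) * b (\<lambda>i. X ((\<rho> \<circ> \<sigma>) (p + i))))"
    by (rule setum_permutations_compose_left[OF \<rho>])
  also have "\<dots> = of_int (sign \<rho>) * (\<Sum>\<sigma> | \<sigma> permutes {..<p + q}.
          of_int (sign \<sigma>) * a (\<lambda>i. X (\<rho> (\<sigma> i))) * b (\<lambda>i. X (\<rho> (\<sigma> (p + i)))))"
    unfolding sum_distrib_left
    by (intro sum.cong refl) (simp add: sign_compose_permutes[OF \<rho>] mult.assoc)
  finally have *: "(\<Sum>\<sigma> | \<sigma> permutes {..<p + q}.
          of_int (sign \<sigma>) * a (\<lambda>i. X (\<sigma> i)) * b (\<lambda>i. X (\<sigma> (p + i))))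
      = of_int (sign \<rho>) * (\<Sum>\<sigma> | \<sigma> permutes {..<p + q}.
          of_int (sign \<sigma>) * a (\<lambda>i. X (\<rho> (\<sigma> i))) * b (\<lambda>i. X (\<rho> (\<sigma> (p + i)))))" .
  have "(of_int (sign \<rho>) :: complex) * of_int (sign \<rho>) = 1"
    by (metis of_int_1 of_int_mult sign_idempotent)
  then show "wedge p q a b (\<lambda>i. X (\<rho> i)) = of_int (sign \<rho>) * wedge p q a b X"
    unfolding wedge_def * by (simp add: mult.assoc[symmetric])
qed

lemma alternating_wedge_power: "alternating (k * p) (wedge_power p a k)"
  by (cases k) (auto simp: alternating_wedge, auto simp: alternating_def)

text \<open>
  A permutation of the arguments of the second factor of a wedge product, regarded as a
  permutation of all arguments: the first \<open>p\<close> stay in place.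
\<close>

definition shift_perm :: "nat \<Rightarrow> nat \<Rightarrow> (nat \<Rightarrow> nat) \<Rightarrow> nat \<Rightarrow> nat" where
  "shift_perm p q \<tau> = map_permutation {..<q} ((+) p) \<tau>"

lemma bij_betw_add_block: "bij_betw ((+) p) {..<q} {p..<p + q :: nat}"
  by (auto simp: bij_betw_def inj_on_def image_iff Bex_def) presburger

lemma shift_perm_permutes_block: "\<tau> permutes {..<q} \<Longrightarrow> shift_perm p q \<tau> permutes {p..<p + q}"
  unfolding shift_perm_def using map_permutation_permutes bij_betw_add_block by blast

lemma shift_perm_permutes: "\<tau> permutes {..<q} \<Longrightarrow> shift_perm p q \<tau> permutes {..<p + q}"
  by (rule permutes_subset[OF shift_perm_permutes_block]) auto

lemma sign_shift_perm: "\<tau> permutes {..<q} \<Longrightarrow> sign (shift_perm p q \<tau>) = sign \<tau>"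
  unfolding shift_perm_def by (rule sign_map_permutation) auto

lemma shift_perm_low: "\<tau> permutes {..<q} \<Longrightarrow> i < p \<Longrightarrow> shift_perm p q \<tau> i = i"
  using permutes_not_in[OF shift_perm_permutes_block] by fastforce

lemma shift_perm_add:
  assumes "\<tau> permutes {..<q}" shows "shift_perm p q \<tau> (p + i) = p + \<tau> i"
proof (cases "i < q")
  case True
  then show ?thesis unfolding shift_perm_def by (subst map_permutation_apply) auto
next
  case False
  then have "shift_perm p q \<tau> (p + i) = p + i"
    using permutes_not_in[OF shift_perm_permutes[OF assms]] by force
  then show ?thesis using permutes_not_in[OF assms, of i] False by simp
qed

lemma sum_permutations_shift:
  fixes f :: "(nat \<Rightarrow> nat) \<Rightarrow> 'a::comm_monoid_add"
  shows "(\<Sum>\<sigma> | \<sigma> permutes {p..<p + q}. f \<sigma>) = (\<Sum>\<tau> | \<tau> permutes {..<q}. f (shift_perm p q \<tau>))"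
proof (rule sum.reindex_bij_betw[symmetric])
  have "shift_perm p q \<pi> = (\<lambda>x. if x \<in> {p..<p + q} then p + \<pi> (inv_into {..<q} ((+) p) x) else x)"
    for \<pi>
    by (auto simp: shift_perm_def map_permutation_def restrict_id_def fun_eq_iff
        bij_betw_imp_surj_on[OF bij_betw_add_block])
  then show "bij_betw (shift_perm p q) {\<tau>. \<tau> permutes {..<q}} {\<sigma>. \<sigma> permutes {p..<p + q}}"
    using bij_betw_permutations[OF bij_betw_add_block, of p q] by presburger
qed

text \<open>
  The substitution used twice in the proof of associativity: the sign of the inner permutation \<open>\<tau>\<close> is
  absorbed by passing from \<open>\<sigma>\<close> to \<open>\<sigma> \<circ> inv \<tau>\<close>.
\<close>

lemma sum_permutations_compose_inv:
  assumes "\<tau> permutes {..<n :: nat}"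
  shows "(\<Sum>\<sigma> | \<sigma> permutes {..<n}. of_int (sign \<sigma>) * of_int (sign \<tau>) * f \<sigma>)
       = (\<Sum>\<sigma> | \<sigma> permutes {..<n}. of_int (sign \<sigma>) * f (\<sigma> \<circ> inv \<tau>) :: complex)"
proof -
  have "sign (\<sigma> \<circ> inv \<tau>) * sign \<tau> = sign \<sigma>" if "\<sigma> permutes {..<n}" for \<sigma>
    using sign_compose_permutes[OF that permutes_inv[OF assms]] assms
    by (simp add: mult.assoc sign_inverse permutation_permutes)
      (metis assms finite_lessThan permutation_permutes sign_idempotent sign_inverse mult.right_neutral)
  then show ?thesis
    by (subst sum_permutations_compose_right[OF permutes_inv[OF assms]])
      (auto intro!: sum.cong simp flip: of_int_mult)
qed

text \<open>
  Both sides are \<open>T / (p! q! r!)\<close> for one sum \<open>T\<close> over the permutations of \<open>p + q + r\<close> indices. Expanding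
  the inner product introduces a second permutation \<open>\<tau>\<close> that acts on the first \<open>p + q\<close> or on the
  last \<open>q + r\<close> indices; for each fixed \<open>\<tau>\<close> the outer sum equals \<open>T\<close>. On the right-hand side
  the substitution also changes what \<open>a\<close> sees beyond its first \<open>p\<close> vectors, so \<open>a\<close> must be a
  genuine \<open>p\<close>-form.
\<close>

lemma wedge_assoc:
  fixes a b c :: "('n::finite) form"
  assumes local: "\<And>X Y. (\<And>i. i < p \<Longrightarrow> X i = Y i) \<Longrightarrow> a X = a Y"
  shows "wedge (p + q) r (wedge p q a b) c = wedge p (q + r) a (wedge q r b c)"
proof
  fix X :: "nat \<Rightarrow> complex^'n"
  let ?P = "{\<sigma>. \<sigma> permutes {..<p + q + r}}"
  let ?s = "\<lambda>\<sigma>. of_int (sign \<sigma>) :: complex"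
  define T where "T = (\<Sum>\<sigma>\<in>?P. ?s \<sigma> * (a (\<lambda>i. X (\<sigma> i)) * b (\<lambda>i. X (\<sigma> (p + i)))
                         * c (\<lambda>i. X (\<sigma> (p + q + i)))))"
  have left: "(\<Sum>\<sigma>\<in>?P. ?s \<sigma> * ?s \<tau> * (a (\<lambda>i. X (\<sigma> (\<tau> i))) * b (\<lambda>i. X (\<sigma> (\<tau> (p + i))))
                * c (\<lambda>i. X (\<sigma> (p + q + i))))) = T"
    if "\<tau> permutes {..<p + q}" for \<tau>
  proof -
    have \<tau>: "\<tau> permutes {..<p + q + r}" by (rule permutes_subset[OF that]) auto
    have high: "inv \<tau> (p + q + i) = p + q + i" for i
      using permutes_not_in[OF permutes_inv[OF that]] by simp
    show ?thesis
      unfolding T_def by (subst sum_permutations_compose_inv[OF \<tau>]) (simp add: high permutes_inverses[OF \<tau>])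
  qed
  have right: "(\<Sum>\<sigma>\<in>?P. ?s \<sigma> * ?s \<tau> * (a (\<lambda>i. X (\<sigma> i)) * b (\<lambda>i. X (\<sigma> (p + \<tau> i)))
                * c (\<lambda>i. X (\<sigma> (p + \<tau> (q + i)))))) = T"
    if "\<tau> permutes {..<q + r}" for \<tau>
  proof -
    define \<tau>' where "\<tau>' = shift_perm p (q + r) \<tau>"
    have \<tau>': "\<tau>' permutes {..<p + q + r}"
      using shift_perm_permutes[OF that, of p] by (simp add: \<tau>'_def add.assoc)
    have sgn: "sign \<tau> = sign \<tau>'" by (simp add: \<tau>'_def sign_shift_perm[OF that])
    have high: "inv \<tau>' (p + \<tau> i) = p + i" for i
      by (subst permutes_inv_eq[OF \<tau>']) (simp add: \<tau>'_def shift_perm_add[OF that])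
    have low: "inv \<tau>' i = i" if "i < p" for i
      by (subst permutes_inv_eq[OF \<tau>']) (simp add: \<tau>'_def shift_perm_low[OF \<open>\<tau> permutes {..<q + r}\<close> that])
    have "a (\<lambda>i. X (\<sigma> (inv \<tau>' i))) = a (\<lambda>i. X (\<sigma> i))" for \<sigma>
      by (rule local) (simp add: low)
    then show ?thesis
      unfolding T_def sgn by (subst sum_permutations_compose_inv[OF \<tau>']) (simp add: high add.assoc)
  qed
  have "wedge (p + q) r (wedge p q a b) c X
      = (\<Sum>\<tau> | \<tau> permutes {..<p + q}. \<Sum>\<sigma>\<in>?P. ?s \<sigma> * ?s \<tau> * (a (\<lambda>i. X (\<sigma> (\<tau> i)))
          * b (\<lambda>i. X (\<sigma> (\<tau> (p + i)))) * c (\<lambda>i. X (\<sigma> (p + q + i)))))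
        / (fact p * fact q) / (fact (p + q) * fact r)"
    unfolding wedge_def
    by (subst sum.swap) (simp add: sum_distrib_left sum_distrib_right sum_divide_distrib mult_ac)
  also have "\<dots> = T / (fact p * fact q * fact r)"
    by (simp add: left card_permutations)
  also have "\<dots> = (\<Sum>\<tau> | \<tau> permutes {..<q + r}. \<Sum>\<sigma>\<in>?P. ?s \<sigma> * ?s \<tau> * (a (\<lambda>i. X (\<sigma> i))
          * b (\<lambda>i. X (\<sigma> (p + \<tau> i))) * c (\<lambda>i. X (\<sigma> (p + \<tau> (q + i))))))
        / (fact q * fact r) / (fact p * fact (q + r))"
    by (simp add: right card_permutations)
  also have "\<dots> = wedge p (q + r) a (wedge q r b c) X"
    unfolding wedge_def
    by (subst sum.swap) (simp add: sum_distrib_left sum_distrib_right sum_divide_distrib mult_ac add.assoc)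
  finally show "wedge (p + q) r (wedge p q a b) c X = wedge p (q + r) a (wedge q r b c) X" .
qed

text \<open>
  Composing a sequence with this permutation brings the entries \<open>2j, 2j + 1\<close> to the front and keeps the
  order of all others.
\<close>

definition block_cycle :: "nat \<Rightarrow> nat \<Rightarrow> nat" where
  "block_cycle j i = (if i < 2 then 2 * j + i else if i < 2 * j + 2 then i - 2 else i)"

lemma block_cycle_Suc:
  "block_cycle (Suc j) =
     Transposition.transpose (2 * j) (2 * j + 2) \<circ> Transposition.transpose (2 * j + 1) (2 * j + 3) \<circ> block_cycle j"
  by (auto simp: fun_eq_iff block_cycle_def Transposition.transpose_def)

text \<open>
  Moving a pair past another pair takes two transpositions, so no sign appears.
\<close>

lemma block_cycle_even_permutation:
  "j \<le> m \<Longrightarrow> block_cycle j permutes {..<2 + 2 * m} \<and> sign (block_cycle j) = 1"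
proof (induction j)
  case 0
  have "block_cycle 0 = id" by (auto simp: fun_eq_iff block_cycle_def)
  then show ?case by (simp only: permutes_id sign_id)
next
  case (Suc j)
  have 1: "Transposition.transpose (2 * j) (2 * j + 2) permutes {..<2 + 2 * m}"
      and 2: "Transposition.transpose (2 * j + 1) (2 * j + 3) permutes {..<2 + 2 * m}"
    using Suc.prems by (auto intro!: permutes_swap_id)
  have 3: "block_cycle j permutes {..<2 + 2 * m}" "sign (block_cycle j) = 1"
    using Suc by auto
  show ?case unfolding block_cycle_Suc
    using permutes_compose[OF 3(1) permutes_compose[OF 2 1]]
    by (simp only: 3 sign_compose_permutes[OF permutes_compose[OF 2 1] 3(1) finite_lessThan]
          sign_compose_permutes[OF 1 2 finite_lessThan])
      (simp add: sign_swap_id)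
qed

text \<open>
  Expansion along a block diagonal 2-form. A permutation contributes only if \<open>\<sigma> 0\<close> and \<open>\<sigma> 1\<close> form one of
  the pairs \<open>{2j, 2j + 1}\<close>. The two orders of the pair contribute equally, because \<open>A\<close> and the sign
  both change; this cancels the factor \<open>2!\<close> of the wedge product. For fixed \<open>j\<close> the remaining sum
  runs over the permutations of the other \<open>2m\<close> vectors, all of which give the same value because \<open>b\<close>
  is alternating; this cancels \<open>(2m)!\<close>.
\<close>

lemma wedge_block_diagonal:
  fixes A :: "complex^'n \<Rightarrow> complex^'n \<Rightarrow> complex" and b :: "('n::finite) form"
  assumes skew: "\<And>x y. A x y = - A y x" and alt: "alternating (2 * m) b"
    and offdiag: "\<And>s t. s < 2 * m + 2 \<Longrightarrow> t < 2 * m + 2 \<Longrightarrow> s div 2 \<noteq> t div 2 \<Longrightarrow> A (X s) (X t) = 0"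
  shows "wedge 2 (2 * m) (\<lambda>X. A (X 0) (X 1)) b X
    = (\<Sum>j\<le>m. A (X (2 * j)) (X (2 * j + 1)) * b (\<lambda>i. X (if i < 2 * j then i else i + 2)))"
proof -
  let ?P = "{\<sigma>. \<sigma> permutes {..<2 + 2 * m}}"
  define f where "f \<sigma> = of_int (sign \<sigma>) * A (X (\<sigma> 0)) (X (\<sigma> 1)) * b (\<lambda>i. X (\<sigma> (2 + i)))" for \<sigma>
  define g where "g j \<sigma> = (if \<sigma> 0 = 2 * j \<and> \<sigma> 1 = 2 * j + 1 then f \<sigma> else 0)" for j \<sigma>
  let ?t = "Transposition.transpose 0 1 :: nat \<Rightarrow> nat"
  have t: "?t permutes {..<2 + 2 * m}" by (rule permutes_swap_id) auto
  \<comment> \<open>exchanging the two arguments of \<open>A\<close> costs two signs\<close>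
  have f_t: "f (\<sigma> \<circ> ?t) = f \<sigma>" if "\<sigma> \<in> ?P" for \<sigma>
  proof -
    have "sign (\<sigma> \<circ> ?t) = - sign \<sigma>"
      using sign_compose_permutes[OF _ t, of \<sigma>] that by (simp add: sign_swap_id del: transpose_apply_first)
    moreover have "?t (Suc (Suc i)) = Suc (Suc i)" for i
      by (simp add: Transposition.transpose_def)
    ultimately show ?thesis
      using skew[of "X (\<sigma> 0)" "X (\<sigma> 1)"] by (simp add: f_def)
  qed
  \<comment> \<open>each permutation that contributes takes \<open>0, 1\<close> to one pair, in one of the two orders\<close>
  have split: "f \<sigma> = (\<Sum>j\<le>m. g j \<sigma>) + (\<Sum>j\<le>m. g j (\<sigma> \<circ> ?t))" if "\<sigma> \<in> ?P" for \<sigma>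
  proof -
    have \<sigma>: "\<sigma> 0 < 2 + 2 * m" "\<sigma> 1 < 2 + 2 * m" "\<sigma> 0 \<noteq> \<sigma> 1"
      using that permutes_in_image[of \<sigma> "{..<2 + 2 * m}"] permutes_inj[of \<sigma> "{..<2 + 2 * m}"]
      by (auto simp: inj_eq)
    let ?d = "\<sigma> 0 div 2"
    show ?thesis
    proof (cases "?d = \<sigma> 1 div 2")
      case False
      then have "f \<sigma> = 0" using offdiag[of "\<sigma> 0" "\<sigma> 1"] \<sigma> by (simp add: f_def)
      moreover have "g j \<sigma> = 0" "g j (\<sigma> \<circ> ?t) = 0" for j
        using False by (auto simp: g_def)
      ultimately show ?thesis by simp
    next
      case True
      have "?d \<le> m" using \<sigma> by linarith
      show ?thesis
      proof (cases "even (\<sigma> 0)")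
        case even: True
        have "\<sigma> 0 = 2 * ?d" "\<sigma> 1 = 2 * ?d + 1"
          using True even \<sigma>(3) by presburger+
        then have "g j \<sigma> = (if j = ?d then f \<sigma> else 0)" "g j (\<sigma> \<circ> ?t) = 0" for j
          unfolding g_def by (auto, presburger?)
        then show ?thesis using \<open>?d \<le> m\<close> by simp
      next
        case odd: False
        have "\<sigma> 0 = 2 * ?d + 1" "\<sigma> 1 = 2 * ?d"
          using True odd \<sigma>(3) by presburger+
        then have "g j (\<sigma> \<circ> ?t) = (if j = ?d then f \<sigma> else 0)" "g j \<sigma> = 0" for j
          unfolding g_def f_t[OF that] by (auto, presburger?)
        then show ?thesis using \<open>?d \<le> m\<close> by simp
      qed
    qed
  qed
  have g_sum: "(\<Sum>\<sigma>\<in>?P. g j \<sigma>) = fact (2 * m) *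
      (A (X (2 * j)) (X (2 * j + 1)) * b (\<lambda>i. X (if i < 2 * j then i else i + 2)))" if "j \<le> m" for j
  proof -
    let ?c = "block_cycle j"
    have c: "?c permutes {..<2 + 2 * m}" and c_sign: "sign ?c = 1"
      using block_cycle_even_permutation[OF that] by auto
    have c_val: "?c \<sigma>0 = 2 * j \<longleftrightarrow> \<sigma>0 = 0" "?c \<sigma>0 = 2 * j + 1 \<longleftrightarrow> \<sigma>0 = 1" for \<sigma>0
      by (auto simp: block_cycle_def)
    \<comment> \<open>composing with \<open>?c\<close> reduces to the permutations that fix \<open>0\<close> and \<open>1\<close>\<close>
    have "(\<Sum>\<sigma>\<in>?P. g j \<sigma>) = (\<Sum>\<sigma>\<in>?P. if \<sigma> 0 = 0 \<and> \<sigma> 1 = 1 then f (?c \<circ> \<sigma>) else 0)"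
      by (subst setum_permutations_compose_left[OF c]) (simp only: g_def o_apply c_val)
    also have "\<dots> = (\<Sum>\<sigma> | \<sigma> \<in> ?P \<and> \<sigma> 0 = 0 \<and> \<sigma> 1 = 1. f (?c \<circ> \<sigma>))"
      by (rule sum.inter_filter[symmetric]) (simp add: finite_permutations)
    also have "{\<sigma>. \<sigma> \<in> ?P \<and> \<sigma> 0 = 0 \<and> \<sigma> 1 = 1} = {\<sigma>. \<sigma> permutes {2..<2 + 2 * m}}"
    proof (intro set_eqI iffI)
      fix \<sigma> assume "\<sigma> \<in> {\<sigma>. \<sigma> permutes {2..<2 + 2 * m}}"
      then show "\<sigma> \<in> {\<sigma>. \<sigma> \<in> ?P \<and> \<sigma> 0 = 0 \<and> \<sigma> 1 = 1}"
        by (auto simp: permutes_not_in intro: permutes_subset)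
    next
      fix \<sigma> assume \<sigma>: "\<sigma> \<in> {\<sigma>. \<sigma> \<in> ?P \<and> \<sigma> 0 = 0 \<and> \<sigma> 1 = 1}"
      have "\<sigma> x = x" if "x \<in> {..<2 + 2 * m} - {2..<2 + 2 * m}" for x
        using \<sigma> that less_2_cases[of x] by auto
      then show "\<sigma> \<in> {\<sigma>. \<sigma> permutes {2..<2 + 2 * m}}"
        using \<sigma> permutes_superset by blast
    qed
    also have "(\<Sum>\<sigma> | \<sigma> permutes {2..<2 + 2 * m}. f (?c \<circ> \<sigma>))
        = (\<Sum>\<rho> | \<rho> permutes {..<2 * m}. f (?c \<circ> shift_perm 2 (2 * m) \<rho>))"
      by (rule sum_permutations_shift)
    also have "\<dots> = (\<Sum>\<rho> | \<rho> permutes {..<2 * m}.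
        A (X (2 * j)) (X (2 * j + 1)) * b (\<lambda>i. X (if i < 2 * j then i else i + 2)))"
    proof (rule sum.cong[OF refl])
      fix \<rho> assume "\<rho> \<in> {\<rho>. \<rho> permutes {..<2 * m}}"
      then have \<rho>: "\<rho> permutes {..<2 * m}" by simp
      let ?s = "shift_perm 2 (2 * m) \<rho>" and ?Y = "\<lambda>i. X (if i < 2 * j then i else i + 2)"
      have low: "?s 0 = 0" "?s 1 = 1" using shift_perm_low[OF \<rho>, of _ 2] by auto
      have "?c (2 + i) = (if i < 2 * j then i else i + 2)" for i
        by (auto simp: block_cycle_def)
      then have "b (\<lambda>i. X ((?c \<circ> ?s) (2 + i))) = b (\<lambda>i. ?Y (\<rho> i))"
        by (simp only: o_apply shift_perm_add[OF \<rho>])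
      also have "\<dots> = of_int (sign \<rho>) * b ?Y" by (rule alternatingD[OF alt \<rho>])
      finally have b: "b (\<lambda>i. X ((?c \<circ> ?s) (2 + i))) = of_int (sign \<rho>) * b ?Y" .
      have s: "sign (?c \<circ> ?s) = sign \<rho>"
        by (simp only: sign_compose_permutes[OF c shift_perm_permutes[OF \<rho>] finite_lessThan]
            c_sign sign_shift_perm[OF \<rho>] mult_1)
      have "(of_int (sign \<rho>) :: complex) * of_int (sign \<rho>) = 1"
        by (metis of_int_1 of_int_mult sign_idempotent)
      moreover have "(?c \<circ> ?s) 0 = 2 * j" "(?c \<circ> ?s) 1 = 2 * j + 1"
        by (simp_all only: o_apply low c_val)
      ultimately show "f (?c \<circ> ?s) = A (X (2 * j)) (X (2 * j + 1)) * b ?Y"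
        unfolding f_def b s by simp
    qed
    finally show ?thesis by (simp add: card_permutations)
  qed
  have "(\<Sum>\<sigma>\<in>?P. f \<sigma>) = (\<Sum>\<sigma>\<in>?P. \<Sum>j\<le>m. g j \<sigma>) + (\<Sum>\<sigma>\<in>?P. \<Sum>j\<le>m. g j (\<sigma> \<circ> ?t))"
    by (simp only: split sum.distrib cong: sum.cong)
  also have "(\<Sum>\<sigma>\<in>?P. \<Sum>j\<le>m. g j (\<sigma> \<circ> ?t)) = (\<Sum>\<sigma>\<in>?P. \<Sum>j\<le>m. g j \<sigma>)"
    by (rule sum_permutations_compose_right[OF t, symmetric])
  also have "(\<Sum>\<sigma>\<in>?P. \<Sum>j\<le>m. g j \<sigma>) = fact (2 * m) *
      (\<Sum>j\<le>m. A (X (2 * j)) (X (2 * j + 1)) * b (\<lambda>i. X (if i < 2 * j then i else i + 2)))"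
    unfolding sum_distrib_left by (subst sum.swap) (rule sum.cong[OF refl], rule g_sum, simp)
  finally show ?thesis
    unfolding wedge_def f_def[symmetric] by simp
qed

section \<open>Simultaneous diagonalisation of Hermitian forms\<close>

definition herm :: "complex^'n^'n \<Rightarrow> complex^'n \<Rightarrow> complex^'n \<Rightarrow> complex" where
  "herm H x y = (\<Sum>k\<in>UNIV. \<Sum>l\<in>UNIV. H $ k $ l * x $ k * cnj (y $ l))"

lemma herm_add_left: "herm H (x + x') y = herm H x y + herm H x' y"
  by (simp add: herm_def algebra_simps sum.distrib)

lemma herm_add_right: "herm H x (y + y') = herm H x y + herm H x y'"
  by (simp add: herm_def algebra_simps sum.distrib)

lemma herm_scale_left: "herm H (c *s x) y = c * herm H x y"
  by (simp add: herm_def sum_distrib_left mult_ac)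

lemma herm_scale_right: "herm H x (c *s y) = cnj c * herm H x y"
  by (simp add: herm_def sum_distrib_left mult_ac)

lemma herm_zero [simp]: "herm H 0 y = 0" "herm H x 0 = 0"
  by (simp_all add: herm_def)

lemma herm_sum_left: "herm H (\<Sum>i\<in>I. f i) y = (\<Sum>i\<in>I. herm H (f i) y)"
  by (induction I rule: infinite_finite_induct) (auto simp: herm_add_left)

lemma herm_diff_left: "herm H (x - x') y = herm H x y - herm H x' y"
  by (simp add: herm_def algebra_simps sum_subtractf)

text \<open>
  Used with the largest Rayleigh quotient as \<open>c\<close>, where this form is semidefinite.
\<close>

lemma herm_matrix_combination: "herm (c *\<^sub>R G - H) x y = c *\<^sub>R herm G x y - herm H x y"
  by (simp add: herm_def algebra_simps sum_subtractf scaleR_sum_right)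

lemma continuous_on_herm_diag: "continuous_on S (\<lambda>x. herm H x x)"
  unfolding herm_def by (intro continuous_intros)

definition hermitian :: "complex^'n^'n \<Rightarrow> bool" where
  "hermitian H \<longleftrightarrow> (\<forall>k l. H $ l $ k = cnj (H $ k $ l))"

definition positive_definite :: "complex^'n^'n \<Rightarrow> bool" where
  "positive_definite G \<longleftrightarrow> hermitian G \<and> (\<forall>x. x \<noteq> 0 \<longrightarrow> Re (herm G x x) > 0)"

lemma herm_swap:
  assumes "hermitian H"
  shows "herm H y x = cnj (herm H x y)"
proof -
  have "cnj (H $ k $ l) = H $ l $ k" for k l
    using assms unfolding hermitian_def by metis
  then show ?thesis
    unfolding herm_def by (subst sum.swap) (simp add: mult_ac)
qed

lemma herm_diag_real:
  assumes "hermitian H"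
  shows "herm H x x = of_real (Re (herm H x x))"
proof -
  have "Im (herm H x x) = - Im (herm H x x)"
    using arg_cong[OF herm_swap[OF assms, of x x], of Im] by simp
  then show ?thesis by (simp add: complex_eq_iff)
qed

lemma herm_diag_scale: "herm H (c *s x) (c *s x) = of_real ((cmod c)\<^sup>2) * herm H x x"
  by (simp only: herm_scale_left herm_scale_right complex_norm_square mult_ac)

text \<open>
  In direction \<open>c y\<close> the form grows from its zero at \<open>e\<close> by \<open>2 Re (cnj c H(e, y)) + |c|\<^sup>2 H(y, y)\<close>; if \<open>H(e, y)\<close>
  were nonzero, the linear term would make this negative for a small \<open>c\<close> opposite to \<open>H(e, y)\<close>.
\<close>

lemma semidefinite_null_vector:
  assumes H: "hermitian H"
    and V: "\<And>x y c. x \<in> V \<Longrightarrow> y \<in> V \<Longrightarrow> x + c *s y \<in> V"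
    and nonneg: "\<And>x. x \<in> V \<Longrightarrow> Re (herm H x x) \<ge> 0"
    and e: "e \<in> V" "Re (herm H e e) = 0" and y: "y \<in> V"
  shows "herm H e y = 0"
proof (rule ccontr)
  define q where "q = herm H e y"
  define r where "r = Re (herm H y y)"
  assume "herm H e y \<noteq> 0"
  then have q: "cmod q > 0" by (simp add: q_def)
  have r: "r \<ge> 0" using nonneg[OF y] by (simp add: r_def)
  \<comment> \<open>small enough that \<open>t * r \<le> 1\<close>, also when \<open>r = 0\<close>\<close>
  define t where "t = 1 / (r + 1)"
  define c where "c = - of_real t * q"
  have "0 \<le> Re (herm H (e + c *s y) (e + c *s y))" by (rule nonneg[OF V[OF e(1) y]])
  also have "\<dots> = - 2 * t * (cmod q)\<^sup>2 + t\<^sup>2 * (cmod q)\<^sup>2 * r"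
  proof -
    have "herm H (e + c *s y) (e + c *s y) = herm H e e + cnj c * q + c * cnj q
        + of_real ((cmod c)\<^sup>2) * herm H y y"
      by (simp only: herm_add_left herm_add_right herm_diag_scale)
        (simp add: herm_scale_left herm_scale_right q_def herm_swap[OF H, of y e])
    moreover have "cnj c * q + c * cnj q = of_real (- 2 * t * (cmod q)\<^sup>2)"
      by (simp add: complex_norm_square c_def mult_ac del: of_real_power)
    moreover have "(cmod c)\<^sup>2 = t\<^sup>2 * (cmod q)\<^sup>2"
      by (simp add: c_def norm_mult power_mult_distrib)
    ultimately have "herm H (e + c *s y) (e + c *s y) = herm H e e + of_real (- 2 * t * (cmod q)\<^sup>2)
        + of_real (t\<^sup>2 * (cmod q)\<^sup>2) * herm H y y"
      by (simp only: add.assoc)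
    then show ?thesis
      by (simp only: plus_complex.sel times_complex.sel Re_complex_of_real Im_complex_of_real e(2) r_def)
  qed
  also have "\<dots> = t * (cmod q)\<^sup>2 * (t * r - 2)" by (simp add: power2_eq_square algebra_simps)
  also have "\<dots> < 0"
  proof -
    have "t > 0" "t * r \<le> 1" using r by (simp_all add: t_def)
    with q show ?thesis by (intro mult_pos_neg) auto
  qed
  finally show False by simp
qed

text \<open>
  One step of the diagonalisation: \<open>e\<close> maximises the quotient \<open>H(x, x) / G(x, x)\<close> on the unit sphere of
  the subspace \<open>V\<close>. If \<open>\<mu>\<close> is the maximum, then \<open>\<mu> G - H\<close> is semidefinite on \<open>V\<close> with null vector \<open>e\<close>, so
  \<open>H(e, y) = \<mu> G(e, y)\<close> for all \<open>y\<close> in \<open>V\<close>.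
\<close>

lemma rayleigh_maximiser:
  fixes G H :: "complex^'n^'n"
  assumes G: "positive_definite G" and H: "hermitian H"
    and V: "\<And>x y c. x \<in> V \<Longrightarrow> y \<in> V \<Longrightarrow> x + c *s y \<in> V" and V0: "0 \<in> V" and "closed V"
    and "\<exists>x\<in>V. x \<noteq> 0"
  obtains e where "e \<in> V" "herm G e e = 1" "\<And>y. y \<in> V \<Longrightarrow> herm G e y = 0 \<Longrightarrow> herm H e y = 0"
proof -
  have Vs: "c *s y \<in> V" if "y \<in> V" for c y using V[OF V0 that, of c] by simp
  have scal: "complex_of_real r *s x = r *\<^sub>R x" for r and x :: "complex^'n"
    by (simp add: vec_eq_iff scaleR_conv_of_real[where 'a = complex])
  have Gpos: "Re (herm G x x) > 0" if "x \<noteq> 0" for x using G that by (simp add: positive_definite_def)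
  have Gh: "hermitian G" using G by (simp add: positive_definite_def)
  let ?K = "V \<inter> sphere 0 1" and ?R = "\<lambda>x. Re (herm H x x) / Re (herm G x x)"
  have Gnz: "Re (herm G x x) \<noteq> 0" if "x \<in> ?K" for x
    using Gpos[of x] that by (cases "x = 0") auto
  obtain x0 where x0: "x0 \<in> V" "x0 \<noteq> 0" using assms by blast
  have "compact ?K" using \<open>closed V\<close> by (simp add: closed_Int_compact)
  moreover have "inverse (norm x0) *\<^sub>R x0 \<in> ?K"
    using x0(2) Vs[OF x0(1), of "of_real (inverse (norm x0))"] unfolding scal by simp
  then have "?K \<noteq> {}" by blast
  moreover have "continuous_on ?K ?R"
    using Gnz by (intro continuous_intros continuous_on_herm_diag ballI)
  ultimately obtain m where m: "m \<in> ?K" "\<forall>x\<in>?K. ?R x \<le> ?R m"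
    using continuous_attains_sup[of ?K ?R] by blast
  define \<mu> where "\<mu> = ?R m"
  have bound: "Re (herm H x x) \<le> \<mu> * Re (herm G x x)" if "x \<in> V" for x
  proof (cases "x = 0")
    case False
    let ?u = "of_real (inverse (norm x)) *s x"
    have "?u \<in> ?K" using False Vs[OF that, of "of_real (inverse (norm x))"] unfolding scal by simp
    then have "?R ?u \<le> \<mu>" using m by (auto simp: \<mu>_def)
    moreover have "?R ?u = ?R x"
      using False by (simp only: herm_diag_scale Re_complex_of_real) (simp add: norm_mult)
    ultimately have "?R x \<le> \<mu>" by (simp only:)
    then show ?thesis using Gpos[OF False] by (simp add: field_simps)
  qed simp
  have "m \<noteq> 0" using m by auto
  define s where "s = inverse (sqrt (Re (herm G m m)))"
  define e where "e = of_real s *s m"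
  have eV: "e \<in> V" using m Vs by (simp add: e_def)
  have Gm: "Re (herm G m m) > 0" using Gpos \<open>m \<noteq> 0\<close> by simp
  then have s2: "s\<^sup>2 * Re (herm G m m) = 1" by (simp add: s_def power_inverse)
  have ee: "herm F e e = of_real (s\<^sup>2) * herm F m m" for F
    using herm_diag_scale[of F "of_real s" m] by (simp add: e_def)
  have "Re (herm G e e) = 1" using s2 by (simp only: ee times_complex.sel) simp
  then have Ge: "herm G e e = 1" using herm_diag_real[OF Gh, of e] by (metis of_real_1)
  let ?Q = "\<mu> *\<^sub>R G - H"
  have "Re (herm H m m) = \<mu> * Re (herm G m m)" using Gm by (simp add: \<mu>_def)
  then have "Re (herm ?Q e e) = 0"
    by (simp add: ee herm_matrix_combination)
  moreover have "?Q $ l $ k = cnj (?Q $ k $ l)" for k l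
    using Gh[unfolded hermitian_def, rule_format, of k l] H[unfolded hermitian_def, rule_format, of k l]
    by simp
  then have "hermitian ?Q" unfolding hermitian_def by blast
  moreover have "Re (herm ?Q x x) \<ge> 0" if "x \<in> V" for x
    using bound[OF that] by (simp add: herm_matrix_combination)
  ultimately have "herm ?Q e y = 0" if "y \<in> V" for y
    using V eV that by (intro semidefinite_null_vector[of ?Q V e y])
  then have "herm H e y = 0" if "y \<in> V" "herm G e y = 0" for y
    using that by (fastforce simp: herm_matrix_combination)
  then show ?thesis using that eV Ge by blast
qed

text \<open>
  The second conjunct says more than orthogonality for \<open>H\<close>: \<open>e i\<close> is \<open>H\<close>-orthogonal to the whole
  \<open>G\<close>-complement of \<open>e 0, \<dots>, e i\<close>, which contains every vector that is chosen later.
\<close>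

lemma simultaneous_diagonalisation_upto:
  fixes G H :: "complex^'n::finite^'n"
  assumes G: "positive_definite G" and H: "hermitian H" and "k \<le> CARD('n)"
  shows "\<exists>e. (\<forall>i<k. \<forall>j<k. herm G (e i) (e j) = of_bool (i = j)) \<and>
     (\<forall>i<k. \<forall>y. (\<forall>j\<le>i. herm G (e j) y = 0) \<longrightarrow> herm H (e i) y = 0)"
  using \<open>k \<le> CARD('n)\<close>
proof (induction k)
  case 0
  show ?case by simp
next
  case (Suc k)
  then obtain e where orth: "\<And>i j. i < k \<Longrightarrow> j < k \<Longrightarrow> herm G (e i) (e j) = of_bool (i = j)"
    and diag: "\<And>i y. i < k \<Longrightarrow> (\<And>j. j \<le> i \<Longrightarrow> herm G (e j) y = 0) \<Longrightarrow> herm H (e i) y = 0"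
    by (metis Suc_leD)
  have Gh: "hermitian G" using G by (simp add: positive_definite_def)
  define V where "V = {y. \<forall>j<k. herm G (e j) y = 0}"
  have "V = (\<Inter>j\<in>{..<k}. {y. herm G (e j) y = 0})" by (auto simp: V_def)
  moreover have "closed {y. herm G (e j) y = 0}" for j
    unfolding herm_def by (intro closed_Collect_eq continuous_intros)
  ultimately have "closed V" by auto
  \<comment> \<open>the \<open>G\<close>-complement \<open>V\<close> is not zero: remove from a vector outside the span its \<open>G\<close>-projection\<close>
  have "vec.span (e ` {..<k}) \<noteq> (UNIV :: (complex^'n) set)"
  proof
    assume "vec.span (e ` {..<k}) = (UNIV :: (complex^'n) set)"
    then have "vec.dim (UNIV :: (complex^'n) set) \<le> card (e ` {..<k})"
      by (intro vec.dim_le_card) auto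
    also have "\<dots> \<le> k" using card_image_le[of "{..<k}" e] by simp
    finally show False using Suc.prems by (simp add: card_cart_basis)
  qed
  then obtain x where x: "x \<notin> vec.span (e ` {..<k})" by blast
  define r where "r = x - (\<Sum>i<k. herm G x (e i) *s e i)"
  have "(\<Sum>i<k. herm G x (e i) *s e i) \<in> vec.span (e ` {..<k})"
    by (intro vec.span_sum vec.span_scale vec.span_base) auto
  then have "r \<noteq> 0" using x by (auto simp: r_def)
  have "herm G r (e j) = 0" if "j < k" for j
  proof -
    have "(\<Sum>i<k. herm G (herm G x (e i) *s e i) (e j)) = (\<Sum>i<k. if i = j then herm G x (e j) else 0)"
      by (intro sum.cong refl) (auto simp: herm_scale_left orth that)
    then show ?thesis using that by (simp add: r_def herm_diff_left herm_sum_left)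
  qed
  then have "r \<in> V" by (simp add: V_def herm_swap[OF Gh, of _ r])
  obtain f where f: "f \<in> V" "herm G f f = 1" "\<And>y. y \<in> V \<Longrightarrow> herm G f y = 0 \<Longrightarrow> herm H f y = 0"
  proof (rule rayleigh_maximiser[OF G H _ _ \<open>closed V\<close>])
    show "x + c *s y \<in> V" if "x \<in> V" "y \<in> V" for x y c
      using that by (simp add: V_def herm_add_right herm_scale_right)
    show "0 \<in> V" by (simp add: V_def)
    show "\<exists>x\<in>V. x \<noteq> 0" using \<open>r \<in> V\<close> \<open>r \<noteq> 0\<close> by blast
  qed blast
  have fe: "herm G (e j) f = 0" "herm G f (e j) = 0" if "j < k" for j
    using f(1) that herm_swap[OF Gh, of f "e j"] by (auto simp: V_def)
  show ?case
  proof (intro exI[of _ "e(k := f)"] conjI allI impI)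
    fix i j assume "i < Suc k" "j < Suc k"
    then show "herm G ((e(k := f)) i) ((e(k := f)) j) = of_bool (i = j)"
      using orth fe f(2) by (auto simp: less_Suc_eq)
  next
    fix i y assume i: "i < Suc k" and y: "\<forall>j\<le>i. herm G ((e(k := f)) j) y = 0"
    show "herm H ((e(k := f)) i) y = 0"
    proof (cases "i = k")
      case True
      have "herm G (e j) y = 0" if "j < k" for j
        using y[rule_format, of j] that True by simp
      then have "y \<in> V" by (simp add: V_def)
      then show ?thesis using f(3) y True by auto
    next
      case False
      then show ?thesis using i y diag[of i y] by (auto split: if_splits)
    qed
  qed
qed

lemma simultaneous_diagonalisation:
  fixes G H :: "complex^'n::finite^'n"
  assumes G: "positive_definite G" and H: "hermitian H"
  obtains e where "\<And>i j. i < CARD('n) \<Longrightarrow> j < CARD('n) \<Longrightarrow> herm G (e i) (e j) = of_bool (i = j)"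
    and "\<And>i j. i < CARD('n) \<Longrightarrow> j < CARD('n) \<Longrightarrow> i \<noteq> j \<Longrightarrow> herm H (e i) (e j) = 0"
    and "vec.span (e ` {..<CARD('n)}) = UNIV"
proof -
  let ?n = "CARD('n)"
  obtain e where orth: "\<And>i j. i < ?n \<Longrightarrow> j < ?n \<Longrightarrow> herm G (e i) (e j) = of_bool (i = j)"
    and diag: "\<And>i y. i < ?n \<Longrightarrow> (\<And>j. j \<le> i \<Longrightarrow> herm G (e j) y = 0) \<Longrightarrow> herm H (e i) y = 0"
    using simultaneous_diagonalisation_upto[OF G H order_refl] by metis
  have "herm H (e i) (e j) = 0" if "i < ?n" "j < ?n" "i \<noteq> j" for i j
  proof (cases "i < j")
    case True
    then show ?thesis using that by (intro diag) (auto simp: orth)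
  next
    case False
    then have "herm H (e j) (e i) = 0" using that by (intro diag) (auto simp: orth)
    then show ?thesis using herm_swap[OF H, of "e i" "e j"] by simp
  qed
  moreover have "vec.span (e ` {..<?n}) = UNIV"
  proof -
    have inj: "inj_on e {..<?n}"
      using orth by (intro inj_onI) (metis lessThan_iff of_bool_eq(1,2) zero_neq_one)
    have "vec.independent (e ` {..<?n})"
    proof (rule vec.independent_if_scalars_zero)
      fix c x assume s: "(\<Sum>x\<in>e ` {..<?n}. c x *s x) = 0" and "x \<in> e ` {..<?n}"
      then obtain j where j: "j < ?n" "x = e j" by auto
      have "0 = herm G (\<Sum>i<?n. c (e i) *s e i) (e j)"
        using s by (simp add: sum.reindex[OF inj])
      also have "\<dots> = (\<Sum>i<?n. if i = j then c (e i) else 0)"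
        unfolding herm_sum_left using j by (intro sum.cong) (auto simp: herm_scale_left orth)
      finally show "c x = 0" using j by simp
    qed simp
    moreover have "card (e ` {..<?n}) = vec.dim (UNIV :: (complex^'n) set)"
      using card_image[OF inj] by (simp add: card_cart_basis)
    ultimately show ?thesis
      using vec.card_eq_dim[of "e ` {..<?n}" UNIV] by auto
  qed
  ultimately show ?thesis using that orth by blast
qed

lemma hermitian_diagonal_zero:
  fixes H :: "complex^'n::finite^'n"
  assumes H: "hermitian H" and diag: "\<And>i j. i \<in> I \<Longrightarrow> j \<in> I \<Longrightarrow> herm H (e i) (e j) = 0"
    and span: "vec.span (e ` I) = UNIV"
  shows "H = 0"
proof -
  have 1: "herm H x (e j) = 0" if "j \<in> I" for x j
  proof -
    have "x \<in> vec.span (e ` I)" using span by simp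
    then show ?thesis
      by (induction rule: vec.span_induct_alt) (auto simp: herm_add_left herm_scale_left diag that)
  qed
  have 2: "herm H x y = 0" for x y
  proof -
    have "y \<in> vec.span (e ` I)" using span by simp
    then show ?thesis
      by (induction rule: vec.span_induct_alt) (auto simp: herm_add_right herm_scale_right 1)
  qed
  have "H $ k $ l = herm H (axis k 1) (axis l 1)" for k l
  proof -
    have "herm H (axis k 1) (axis l 1) = (\<Sum>i\<in>UNIV. \<Sum>j\<in>UNIV. if j = l then if i = k then H $ i $ j else 0 else 0)"
      unfolding herm_def by (intro sum.cong refl) (auto simp: axis_def)
    then show ?thesis by simp
  qed
  then show ?thesis using 2 by (simp add: vec_eq_iff)
qed

section \<open>The complex Hessian\<close>

lemma derivative_along_line:
  fixes g :: "'a::real_normed_vector \<Rightarrow> real"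
  assumes "g differentiable (at (w + s *\<^sub>R a))"
  shows "((\<lambda>s. g (w + s *\<^sub>R a)) has_real_derivative frechet_derivative g (at (w + s *\<^sub>R a)) a) (at s)"
proof -
  let ?D = "frechet_derivative g (at (w + s *\<^sub>R a))"
  have D: "(g has_derivative ?D) (at (w + s *\<^sub>R a))"
    using assms frechet_derivative_works by blast
  have "((\<lambda>s. w + s *\<^sub>R a) has_derivative (\<lambda>h. h *\<^sub>R a)) (at s)"
    by (auto intro!: derivative_eq_intros)
  from diff_chain_at[OF this D]
  have "((\<lambda>s. g (w + s *\<^sub>R a)) has_derivative (\<lambda>h. ?D (h *\<^sub>R a))) (at s)"
    by (simp add: o_def)
  moreover have "?D (h *\<^sub>R a) = ?D a * h" for h
    using linear_scale[OF has_derivative_linear[OF D]] by simp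
  ultimately show ?thesis by (simp add: has_field_derivative_def)
qed

text \<open>
  The mean value theorem in direction \<open>a\<close>, applied to \<open>x \<mapsto> f (x + h b) - f x\<close>, and then in direction
  \<open>b\<close>, applied to the derivative of \<open>f\<close> along \<open>a\<close>.
\<close>

lemma second_difference_mean_value:
  fixes f :: "'a::real_normed_vector \<Rightarrow> real"
  assumes f: "\<And>x. x \<in> S \<Longrightarrow> f differentiable (at x)"
    and Df: "\<And>x. x \<in> S \<Longrightarrow> (\<lambda>x. frechet_derivative f (at x) a) differentiable (at x)"
    and h: "h > 0" and S: "\<And>s t. 0 \<le> s \<Longrightarrow> s \<le> h \<Longrightarrow> 0 \<le> t \<Longrightarrow> t \<le> h \<Longrightarrow> z + s *\<^sub>R a + t *\<^sub>R b \<in> S"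
  obtains \<xi> \<eta> where "0 < \<xi>" "\<xi> < h" "0 < \<eta>" "\<eta> < h"
    "f (z + h *\<^sub>R a + h *\<^sub>R b) - f (z + h *\<^sub>R a) - f (z + h *\<^sub>R b) + f z
      = h\<^sup>2 * frechet_derivative (\<lambda>x. frechet_derivative f (at x) a) (at (z + \<xi> *\<^sub>R a + \<eta> *\<^sub>R b)) b"
proof -
  let ?D = "\<lambda>x. frechet_derivative f (at x) a"
  have S0: "z + s *\<^sub>R a \<in> S" if "0 \<le> s" "s \<le> h" for s
    using S[of s 0] that h by simp
  have Sh: "z + h *\<^sub>R b + s *\<^sub>R a \<in> S" if "0 \<le> s" "s \<le> h" for s
    using S[of s h] that h by (simp add: add_ac)
  have "((\<lambda>s. f (z + h *\<^sub>R b + s *\<^sub>R a) - f (z + s *\<^sub>R a)) has_real_derivative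
        ?D (z + h *\<^sub>R b + s *\<^sub>R a) - ?D (z + s *\<^sub>R a)) (at s)" if "0 \<le> s" "s \<le> h" for s
    using that by (intro DERIV_diff derivative_along_line f S0 Sh)
  from MVT2[OF h this] obtain \<xi> where \<xi>: "0 < \<xi>" "\<xi> < h"
    "f (z + h *\<^sub>R b + h *\<^sub>R a) - f (z + h *\<^sub>R a) - (f (z + h *\<^sub>R b) - f z)
       = h * (?D (z + h *\<^sub>R b + \<xi> *\<^sub>R a) - ?D (z + \<xi> *\<^sub>R a))"
    by auto
  have "((\<lambda>t. ?D (z + \<xi> *\<^sub>R a + t *\<^sub>R b)) has_real_derivative
        frechet_derivative ?D (at (z + \<xi> *\<^sub>R a + t *\<^sub>R b)) b) (at t)" if "0 \<le> t" "t \<le> h" for t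
    using that \<xi> by (intro derivative_along_line Df S) auto
  from MVT2[OF h this] obtain \<eta> where \<eta>: "0 < \<eta>" "\<eta> < h"
    "?D (z + \<xi> *\<^sub>R a + h *\<^sub>R b) - ?D (z + \<xi> *\<^sub>R a)
       = h * frechet_derivative ?D (at (z + \<xi> *\<^sub>R a + \<eta> *\<^sub>R b)) b"
    by auto
  have "f (z + h *\<^sub>R a + h *\<^sub>R b) - f (z + h *\<^sub>R a) - f (z + h *\<^sub>R b) + f z
      = h * (?D (z + \<xi> *\<^sub>R a + h *\<^sub>R b) - ?D (z + \<xi> *\<^sub>R a))"
    using \<xi>(3) by (simp add: add_ac)
  also have "\<dots> = h\<^sup>2 * frechet_derivative ?D (at (z + \<xi> *\<^sub>R a + \<eta> *\<^sub>R b)) b"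
    by (simp only: \<eta>(3)) (simp add: power2_eq_square)
  finally show ?thesis using that \<xi> \<eta> by blast
qed

text \<open>
  Schwarz's theorem. The second difference is symmetric in \<open>a\<close> and \<open>b\<close>, so near \<open>z\<close> there are points at
  which the two mixed derivatives agree; by continuity they agree at \<open>z\<close>.
\<close>

lemma second_derivative_symmetric:
  fixes f :: "'a::real_normed_vector \<Rightarrow> real"
  assumes "open S" and "C_k_on 2 S f" and z: "z \<in> S"
  shows "frechet_derivative (\<lambda>x. frechet_derivative f (at x) a) (at z) b
       = frechet_derivative (\<lambda>x. frechet_derivative f (at x) b) (at z) a"
proof -
  define D2 where "D2 a b x = frechet_derivative (\<lambda>x. frechet_derivative f (at x) a) (at x) b" for a b x
  have f: "\<And>x. x \<in> S \<Longrightarrow> f differentiable (at x)"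
    and Df: "\<And>a x. x \<in> S \<Longrightarrow> (\<lambda>x. frechet_derivative f (at x) a) differentiable (at x)"
    and cont: "\<And>a b. continuous_on S (D2 a b)"
    using assms(2) by (auto simp: numeral_2_eq_2 D2_def[abs_def])
  have "\<bar>D2 a b z - D2 b a z\<bar> \<le> \<epsilon>" if "\<epsilon> > 0" for \<epsilon>
  proof -
    have near: "\<exists>\<delta>>0. \<forall>x. dist x z < \<delta> \<longrightarrow> \<bar>D2 a b x - D2 a b z\<bar> < \<epsilon> / 2" for a b
    proof -
      have "isCont (D2 a b) z" using cont z \<open>open S\<close> by (simp add: continuous_on_eq_continuous_at)
      then show ?thesis using \<open>\<epsilon> > 0\<close> unfolding continuous_at_eps_delta dist_real_def
        by (metis half_gt_zero)
    qed
    obtain \<delta>1 where \<delta>1: "\<delta>1 > 0" "\<And>x. dist x z < \<delta>1 \<Longrightarrow> \<bar>D2 a b x - D2 a b z\<bar> < \<epsilon> / 2"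
      using near by blast
    obtain \<delta>2 where \<delta>2: "\<delta>2 > 0" "\<And>x. dist x z < \<delta>2 \<Longrightarrow> \<bar>D2 b a x - D2 b a z\<bar> < \<epsilon> / 2"
      using near by blast
    obtain \<delta>3 where \<delta>3: "\<delta>3 > 0" "ball z \<delta>3 \<subseteq> S"
      using \<open>open S\<close> z openE by blast
    define \<delta> where "\<delta> = min \<delta>1 (min \<delta>2 \<delta>3)"
    define N where "N = norm a + norm b + 1"
    define h where "h = \<delta> / (2 * N)"
    have N: "N > 0" "norm a + norm b < N" unfolding N_def by (auto intro: add_nonneg_pos)
    have "\<delta> > 0" using \<delta>1 \<delta>2 \<delta>3 by (simp add: \<delta>_def)
    then have h: "h > 0" using N by (simp add: h_def)
    have close: "dist (z + s *\<^sub>R a + t *\<^sub>R b) z < \<delta>" if "0 \<le> s" "s \<le> h" "0 \<le> t" "t \<le> h" for s t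
    proof -
      have "dist (z + s *\<^sub>R a + t *\<^sub>R b) z = norm (s *\<^sub>R a + t *\<^sub>R b)"
        by (simp add: dist_norm)
      also have "\<dots> \<le> s * norm a + t * norm b"
        using norm_triangle_ineq[of "s *\<^sub>R a" "t *\<^sub>R b"] that by simp
      also have "\<dots> \<le> h * norm a + h * norm b"
        using that by (intro add_mono mult_right_mono) auto
      also have "\<dots> \<le> h * N"
        using h N by (simp flip: distrib_left)
      also have "\<dots> < \<delta>" using N \<open>\<delta> > 0\<close> by (simp add: h_def)
      finally show ?thesis .
    qed
    have inS: "z + s *\<^sub>R a + t *\<^sub>R b \<in> S" if "0 \<le> s" "s \<le> h" "0 \<le> t" "t \<le> h" for s t
      using close[OF that] \<delta>3 by (auto simp: \<delta>_def dist_commute)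
    obtain \<xi> \<eta> where 1: "0 < \<xi>" "\<xi> < h" "0 < \<eta>" "\<eta> < h"
      "f (z + h *\<^sub>R a + h *\<^sub>R b) - f (z + h *\<^sub>R a) - f (z + h *\<^sub>R b) + f z
        = h\<^sup>2 * D2 a b (z + \<xi> *\<^sub>R a + \<eta> *\<^sub>R b)"
      using second_difference_mean_value[OF f Df h inS] unfolding D2_def by blast
    have inS': "z + s *\<^sub>R b + t *\<^sub>R a \<in> S" if "0 \<le> s" "s \<le> h" "0 \<le> t" "t \<le> h" for s t
      using inS[OF that(3,4,1,2)] by (simp add: add_ac)
    obtain \<xi>' \<eta>' where 2: "0 < \<xi>'" "\<xi>' < h" "0 < \<eta>'" "\<eta>' < h"
      "f (z + h *\<^sub>R b + h *\<^sub>R a) - f (z + h *\<^sub>R b) - f (z + h *\<^sub>R a) + f z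
        = h\<^sup>2 * D2 b a (z + \<xi>' *\<^sub>R b + \<eta>' *\<^sub>R a)"
      using second_difference_mean_value[OF f Df h inS'] unfolding D2_def by blast
    have swap: "z + h *\<^sub>R b + h *\<^sub>R a = z + h *\<^sub>R a + h *\<^sub>R b" by simp
    have "h\<^sup>2 * D2 a b (z + \<xi> *\<^sub>R a + \<eta> *\<^sub>R b) = h\<^sup>2 * D2 b a (z + \<xi>' *\<^sub>R b + \<eta>' *\<^sub>R a)"
      using 1(5) 2(5)[unfolded swap] by linarith
    then have eq: "D2 a b (z + \<xi> *\<^sub>R a + \<eta> *\<^sub>R b) = D2 b a (z + \<eta>' *\<^sub>R a + \<xi>' *\<^sub>R b)"
      using h by (simp add: add_ac)
    have "\<bar>D2 a b (z + \<xi> *\<^sub>R a + \<eta> *\<^sub>R b) - D2 a b z\<bar> < \<epsilon> / 2"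
      using 1 close[of \<xi> \<eta>] by (intro \<delta>1) (simp add: \<delta>_def)
    moreover have "\<bar>D2 b a (z + \<eta>' *\<^sub>R a + \<xi>' *\<^sub>R b) - D2 b a z\<bar> < \<epsilon> / 2"
      using 2 close[of \<eta>' \<xi>'] by (intro \<delta>2) (simp add: \<delta>_def)
    ultimately show ?thesis using eq by linarith
  qed
  then have "\<bar>D2 a b z - D2 b a z\<bar> \<le> 0" by (rule field_le_epsilon) simp
  then show ?thesis by (simp add: D2_def)
qed

lemma has_derivative_complex_combination:
  fixes p q :: "'a::real_normed_vector \<Rightarrow> real"
  assumes "p differentiable (at z)" "q differentiable (at z)"
  shows "((\<lambda>w. (complex_of_real (p w) + \<i> * complex_of_real (q w)) / 2) has_derivative
     (\<lambda>b. (complex_of_real (frechet_derivative p (at z) b) + \<i> * complex_of_real (frechet_derivative q (at z) b)) / 2)) (at z)"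
  using assms unfolding frechet_derivative_works
  by (auto intro!: derivative_eq_intros)

lemma frechet_derivative_of_real:
  fixes u :: "'a::real_normed_vector \<Rightarrow> real"
  assumes "u differentiable (at w)"
  shows "frechet_derivative (\<lambda>w. complex_of_real (u w)) (at w) = (\<lambda>a. complex_of_real (frechet_derivative u (at w) a))"
proof -
  have "((\<lambda>w. complex_of_real (u w)) has_derivative (\<lambda>a. complex_of_real (frechet_derivative u (at w) a))) (at w)"
    using assms unfolding frechet_derivative_works by (auto intro!: derivative_eq_intros)
  then show ?thesis by (rule frechet_derivative_at[symmetric])
qed

definition complex_hessian :: "(complex^'n \<Rightarrow> real) \<Rightarrow> complex^'n \<Rightarrow> complex^'n^'n::finite" where
  "complex_hessian u z = (\<chi> k l. wirtinger k (wirtinger_bar l (\<lambda>w. complex_of_real (u w))) z)"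

text \<open>
  The entry \<open>k, l\<close> is \<open>(P(l, k) + P(il, ik) + i (P(il, k) - P(l, ik))) / 4\<close> in terms of the real second
  derivatives \<open>P\<close>, with \<open>k\<close> and \<open>ik\<close> for the directions \<open>axis k 1\<close> and \<open>axis k \<i>\<close>, and
  exchanging \<open>k\<close> and \<open>l\<close> conjugates it if \<open>P\<close> is symmetric.
\<close>

lemma hermitian_complex_hessian:
  fixes u :: "complex^'n::finite \<Rightarrow> real"
  assumes S: "open S" and u: "C_k_on 2 S u" and z: "z \<in> S"
  shows "hermitian (complex_hessian u z)"
proof -
  define D where "D a x = frechet_derivative u (at x) a" for a x
  define P where "P a b = frechet_derivative (D a) (at z) b" for a b
  have du: "\<And>x. x \<in> S \<Longrightarrow> u differentiable (at x)"
    and dD: "\<And>a. D a differentiable (at z)"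
    using u z by (auto simp: numeral_2_eq_2 D_def[abs_def])
  have P_sym: "P a b = P b a" for a b
    unfolding P_def D_def by (rule second_derivative_symmetric[OF S u z])
  have bar: "frechet_derivative (wirtinger_bar l (\<lambda>w. complex_of_real (u w))) (at z) b
      = (complex_of_real (P (axis l 1) b) + \<i> * complex_of_real (P (axis l \<i>) b)) / 2" for l b
  proof -
    have eq: "(complex_of_real (D (axis l 1) x) + \<i> * complex_of_real (D (axis l \<i>) x)) / 2
        = wirtinger_bar l (\<lambda>w. complex_of_real (u w)) x" if "x \<in> S" for x
      by (simp add: wirtinger_bar_def frechet_derivative_of_real[OF du[OF that]] D_def)
    have "(wirtinger_bar l (\<lambda>w. complex_of_real (u w)) has_derivative
       (\<lambda>b. (complex_of_real (P (axis l 1) b) + \<i> * complex_of_real (P (axis l \<i>) b)) / 2)) (at z)"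
      unfolding P_def
      by (rule has_derivative_transform_within_open[OF has_derivative_complex_combination[OF dD dD] S z eq])
    then show ?thesis by (simp only: frechet_derivative_at[symmetric])
  qed
  have entry: "complex_hessian u z $ k $ l =
      Complex (P (axis l 1) (axis k 1) + P (axis l \<i>) (axis k \<i>)) (P (axis l \<i>) (axis k 1) - P (axis l 1) (axis k \<i>)) / 4"
    for k l
    by (simp add: complex_hessian_def wirtinger_def bar complex_eq_iff)
  have "complex_hessian u z $ l $ k = cnj (complex_hessian u z $ k $ l)" for k l
    unfolding entry
      P_sym[of "axis k 1" "axis l 1"] P_sym[of "axis k 1" "axis l \<i>"]
      P_sym[of "axis k \<i>" "axis l 1"] P_sym[of "axis k \<i>" "axis l \<i>"]
    by (simp add: complex_eq_iff)
  then show ?thesis unfolding hermitian_def by blast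
qed

section \<open>Wedge products of diagonal (1,1)-forms\<close>

lemma wedge_one_forms:
  "wedge 1 1 (\<lambda>X. f (X 0)) (\<lambda>X. g (X 0)) X = f (X 0) * g (X 1) - f (X 1) * g (X 0)"
proof -
  have "{..<1 + 1 :: nat} = {0, 1}" by auto
  then have "{\<sigma>. \<sigma> permutes {..<1 + 1 :: nat}} = {id, Transposition.transpose 0 1}"
    by (simp add: permutes_doubleton_iff) blast
  moreover have "id \<noteq> Transposition.transpose 0 (1 :: nat)"
    by (metis id_apply transpose_apply_first zero_neq_one)
  ultimately show ?thesis by (simp add: wedge_def sign_swap_id)
qed

lemma form11_herm: "form11 H = (\<lambda>X. \<i> / 2 * (herm H (X 0) (X 1) - herm H (X 1) (X 0)))"
  unfolding form11_def dz_def dz_bar_def herm_def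
    wedge_one_forms[where f = "\<lambda>x. x $ k" and g = "\<lambda>x. cnj (x $ l)" for k l]
  by (simp add: algebra_simps sum_subtractf)

text \<open>
  The real tangent vectors \<open>e\<^sub>0, i e\<^sub>0, e\<^sub>1, i e\<^sub>1, \<dots>\<close>, in the order that puts each complex line into one block.
\<close>

definition real_frame :: "(nat \<Rightarrow> complex^'n) \<Rightarrow> nat \<Rightarrow> complex^'n" where
  "real_frame e s = (if even s then 1 else \<i>) *s e (s div 2)"

text \<open>
  The increasing enumeration of the natural numbers other than \<open>j\<close>.
\<close>

definition skip :: "nat \<Rightarrow> nat \<Rightarrow> nat" where
  "skip j i = (if i < j then i else Suc i)"

lemma sum_skip:
  fixes f :: "nat \<Rightarrow> 'a::ab_group_add"
  assumes "j \<le> Suc m"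
  shows "(\<Sum>i\<le>m. f (skip j i)) = (\<Sum>i\<le>Suc m. f i) - f j"
proof -
  have "bij_betw (skip j) {..m} ({..Suc m} - {j})"
  proof (rule bij_betwI[where g = "\<lambda>i. if i < j then i else i - 1"])
  qed (use assms in \<open>auto simp: skip_def split: if_splits\<close>)
  then have "(\<Sum>i\<le>m. f (skip j i)) = (\<Sum>i\<in>{..Suc m} - {j}. f i)"
    by (rule sum.reindex_bij_betw)
  then show ?thesis using assms by (simp add: sum_diff1)
qed

text \<open>
  On a frame that is orthogonal for \<open>H\<close>, the 2-form of \<open>H\<close> pairs \<open>e\<^sub>j\<close> only with \<open>i e\<^sub>j\<close>, and its value on this
  pair is \<open>H(e\<^sub>j, e\<^sub>j)\<close>; this is where the factor \<open>i/2\<close> in the convention for (1,1)-forms is needed.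
\<close>

lemma wedge_form11_frame:
  fixes H :: "complex^'n::finite^'n"
  assumes alt: "alternating (2 * m) b"
    and diag: "\<And>i j. i \<le> m \<Longrightarrow> j \<le> m \<Longrightarrow> i \<noteq> j \<Longrightarrow> herm H (e i) (e j) = 0"
  shows "wedge 2 (2 * m) (form11 H) b (real_frame e)
       = (\<Sum>j\<le>m. herm H (e j) (e j) * b (real_frame (e \<circ> skip j)))"
proof -
  let ?A = "\<lambda>x y. \<i> / 2 * (herm H x y - herm H y x)"
  have "wedge 2 (2 * m) (form11 H) b (real_frame e)
      = (\<Sum>j\<le>m. ?A (real_frame e (2 * j)) (real_frame e (2 * j + 1))
                 * b (\<lambda>i. real_frame e (if i < 2 * j then i else i + 2)))"
    unfolding form11_herm
  proof (rule wedge_block_diagonal[OF _ alt])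
    fix s t assume "s < 2 * m + 2" "t < 2 * m + 2" "s div 2 \<noteq> t div 2"
    then show "?A (real_frame e s) (real_frame e t) = 0"
      by (simp add: real_frame_def herm_scale_left herm_scale_right diag)
  qed (simp add: algebra_simps)
  also have "\<dots> = (\<Sum>j\<le>m. herm H (e j) (e j) * b (real_frame (e \<circ> skip j)))"
  proof (intro sum.cong refl arg_cong2[where f = "(*)"])
    fix j
    show "?A (real_frame e (2 * j)) (real_frame e (2 * j + 1)) = herm H (e j) (e j)"
      by (simp add: real_frame_def herm_scale_left herm_scale_right)
    have "real_frame e (if i < 2 * j then i else i + 2) = real_frame (e \<circ> skip j) i" for i
      by (auto simp: real_frame_def skip_def)
    then show "b (\<lambda>i. real_frame e (if i < 2 * j then i else i + 2)) = b (real_frame (e \<circ> skip j))"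
      by (simp only:)
  qed
  finally show ?thesis .
qed

text \<open>
  The recursion for powers ends in the constant 0-form, so this is the base of the square
  below.
\<close>

lemma wedge_form11_one: "wedge 2 0 (form11 H) (\<lambda>X. 1) = form11 H"
proof
  fix X :: "nat \<Rightarrow> complex^'a"
  have "wedge 2 (2 * 0) (\<lambda>X. \<i> / 2 * (herm H (X 0) (X 1) - herm H (X 1) (X 0))) (\<lambda>X. 1) X
      = \<i> / 2 * (herm H (X 0) (X 1) - herm H (X 1) (X 0))"
    by (subst wedge_block_diagonal[where m = 0]) (auto simp: alternating_def algebra_simps)
  then show "wedge 2 0 (form11 H) (\<lambda>X. 1) X = form11 H X" by (simp add: form11_herm)
qed

lemma alternating_form_power: "alternating (2 * m) (wedge_power 2 a m)"
  using alternating_wedge_power[of m 2 a] by (simp add: mult.commute)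

text \<open>
  Removing one vector leaves an orthonormal frame, so each of the \<open>m + 1\<close> terms of the expansion equals
  the value for the smaller power.
\<close>

lemma form11_power_frame:
  fixes G :: "complex^'n::finite^'n"
  assumes "\<And>i j. i < m \<Longrightarrow> j < m \<Longrightarrow> herm G (e i) (e j) = of_bool (i = j)"
  shows "wedge_power 2 (form11 G) m (real_frame e) = fact m"
  using assms
proof (induction m arbitrary: e)
  case (Suc m)
  have "wedge_power 2 (form11 G) (Suc m) (real_frame e)
      = (\<Sum>j\<le>m. herm G (e j) (e j) * wedge_power 2 (form11 G) m (real_frame (e \<circ> skip j)))"
    using wedge_form11_frame[OF alternating_form_power[of m "form11 G"], of G e] Suc.prems
    by (simp add: mult.commute)
  also have "\<dots> = (\<Sum>j\<le>m. fact m)"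
  proof (rule sum.cong[OF refl])
    fix j assume "j \<in> {..m}"
    moreover have "wedge_power 2 (form11 G) m (real_frame (e \<circ> skip j)) = fact m"
      by (rule Suc.IH) (auto simp: Suc.prems skip_def)
    ultimately show "herm G (e j) (e j) * wedge_power 2 (form11 G) m (real_frame (e \<circ> skip j)) = fact m"
      using Suc.prems by simp
  qed
  finally show ?case by (simp add: algebra_simps)
qed simp

lemma wedge_first_symmetric_frame:
  fixes G H :: "complex^'n::finite^'n"
  assumes orth: "\<And>i j. i \<le> m \<Longrightarrow> j \<le> m \<Longrightarrow> herm G (e i) (e j) = of_bool (i = j)"
    and diag: "\<And>i j. i \<le> m \<Longrightarrow> j \<le> m \<Longrightarrow> i \<noteq> j \<Longrightarrow> herm H (e i) (e j) = 0"
  shows "wedge 2 (2 * m) (form11 H) (wedge_power 2 (form11 G) m) (real_frame e)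
       = fact m * (\<Sum>j\<le>m. herm H (e j) (e j))"
proof -
  have "wedge_power 2 (form11 G) m (real_frame (e \<circ> skip j)) = fact m" for j
    by (rule form11_power_frame) (auto simp: orth skip_def)
  then show ?thesis
    by (subst wedge_form11_frame[OF alternating_form_power diag]) (simp_all add: sum_distrib_left mult.commute)
qed

text \<open>
  Expanding along both copies of the form of \<open>H\<close> gives, up to the factor \<open>m!\<close>, the sum of
  \<open>\<mu>\<^sub>i \<mu>\<^sub>j = H(e\<^sub>i, e\<^sub>i) H(e\<^sub>j, e\<^sub>j)\<close> over ordered pairs of distinct indices, that is, twice the second elementary symmetric function of the \<open>\<mu>\<^sub>j\<close>.
\<close>

lemma wedge_second_symmetric_frame:
  fixes G H :: "complex^'n::finite^'n"
  assumes orth: "\<And>i j. i \<le> Suc m \<Longrightarrow> j \<le> Suc m \<Longrightarrow> herm G (e i) (e j) = of_bool (i = j)"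
    and diag: "\<And>i j. i \<le> Suc m \<Longrightarrow> j \<le> Suc m \<Longrightarrow> i \<noteq> j \<Longrightarrow> herm H (e i) (e j) = 0"
  shows "wedge 4 (2 * m) (wedge_power 2 (form11 H) 2) (wedge_power 2 (form11 G) m) (real_frame e)
       = fact m * ((\<Sum>j\<le>Suc m. herm H (e j) (e j))\<^sup>2 - (\<Sum>j\<le>Suc m. (herm H (e j) (e j))\<^sup>2))"
proof -
  let ?\<omega> = "wedge_power 2 (form11 G) m" and ?S = "\<Sum>j\<le>Suc m. herm H (e j) (e j)"
  have sq: "wedge_power 2 (form11 H) 2 = wedge 2 2 (form11 H) (form11 H)"
    by (simp add: numeral_2_eq_2 wedge_form11_one[unfolded numeral_2_eq_2])
  have "wedge (2 + 2) (2 * m) (wedge 2 2 (form11 H) (form11 H)) ?\<omega>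
      = wedge 2 (2 + 2 * m) (form11 H) (wedge 2 (2 * m) (form11 H) ?\<omega>)"
    by (rule wedge_assoc) (simp add: form11_herm)
  then have "wedge 4 (2 * m) (wedge_power 2 (form11 H) 2) ?\<omega> (real_frame e)
      = wedge 2 (2 * Suc m) (form11 H) (wedge 2 (2 * m) (form11 H) ?\<omega>) (real_frame e)"
    by (simp add: sq)
  also have "\<dots> = (\<Sum>j\<le>Suc m. herm H (e j) (e j) * wedge 2 (2 * m) (form11 H) ?\<omega> (real_frame (e \<circ> skip j)))"
    using alternating_wedge[of 2 "2 * m" "form11 H" ?\<omega>]
    by (intro wedge_form11_frame diag) auto
  also have "\<dots> = (\<Sum>j\<le>Suc m. herm H (e j) (e j) * (fact m * (?S - herm H (e j) (e j))))"
  proof (intro sum.cong refl arg_cong2[where f = "(*)"])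
    fix j assume j: "j \<in> {..Suc m}"
    have "wedge 2 (2 * m) (form11 H) ?\<omega> (real_frame (e \<circ> skip j))
        = fact m * (\<Sum>i\<le>m. herm H ((e \<circ> skip j) i) ((e \<circ> skip j) i))"
      by (rule wedge_first_symmetric_frame) (auto simp: orth diag skip_def)
    also have "(\<Sum>i\<le>m. herm H ((e \<circ> skip j) i) ((e \<circ> skip j) i)) = ?S - herm H (e j) (e j)"
      using sum_skip[of j m "\<lambda>i. herm H (e i) (e i)"] j by simp
    finally show "wedge 2 (2 * m) (form11 H) ?\<omega> (real_frame (e \<circ> skip j)) = fact m * (?S - herm H (e j) (e j))" .
  qed
  also have "\<dots> = fact m * (?S * ?S - (\<Sum>j\<le>Suc m. (herm H (e j) (e j))\<^sup>2))"
    unfolding right_diff_distrib sum_subtractf sum_distrib_left sum_distrib_right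
    by (simp only: power2_eq_square mult_ac)
  finally show ?thesis by (simp only: power2_eq_square)
qed

text \<open>
  The core of the theorem at a point, in dimension \<open>m + 2\<close>: real numbers whose sum and whose second
  elementary symmetric function vanish have vanishing sum of squares.
\<close>

lemma hermitian_zero_if_wedges_vanish:
  fixes G H :: "complex^'n::finite^'n"
  assumes G: "positive_definite G" and H: "hermitian H" and n: "CARD('n) = m + 2"
    and first: "wedge 2 (2 * Suc m) (form11 H) (wedge_power 2 (form11 G) (Suc m)) = (\<lambda>X. 0)"
    and second: "wedge 4 (2 * m) (wedge_power 2 (form11 H) 2) (wedge_power 2 (form11 G) m) = (\<lambda>X. 0)"
  shows "H = 0"
proof -
  obtain e where orth: "\<And>i j. i < CARD('n) \<Longrightarrow> j < CARD('n) \<Longrightarrow> herm G (e i) (e j) = of_bool (i = j)"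
    and diag: "\<And>i j. i < CARD('n) \<Longrightarrow> j < CARD('n) \<Longrightarrow> i \<noteq> j \<Longrightarrow> herm H (e i) (e j) = 0"
    and span: "vec.span (e ` {..<CARD('n)}) = UNIV"
    by (rule simultaneous_diagonalisation[OF G H]) blast
  define \<mu> where "\<mu> j = Re (herm H (e j) (e j))" for j
  have eigenvalue: "herm H (e j) (e j) = of_real (\<mu> j)" for j
    unfolding \<mu>_def by (rule herm_diag_real[OF H])
  have "(\<Sum>j\<le>Suc m. herm H (e j) (e j)) = 0"
    using wedge_first_symmetric_frame[of "Suc m" G e H] orth diag first
    by (simp add: n del: fact_Suc wedge_power.simps sum.atMost_Suc)
  moreover from this have "(\<Sum>j\<le>Suc m. (herm H (e j) (e j))\<^sup>2) = 0"
    using wedge_second_symmetric_frame[of m G e H] orth diag second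
    by (simp add: n del: sum.atMost_Suc wedge_power.simps)
  then have "complex_of_real (\<Sum>j\<le>Suc m. (\<mu> j)\<^sup>2) = of_real 0"
    by (simp only: eigenvalue of_real_sum of_real_power of_real_0)
  then have "(\<Sum>j\<le>Suc m. (\<mu> j)\<^sup>2) = 0" by (simp only: of_real_eq_iff)
  then have "\<mu> j = 0" if "j \<le> Suc m" for j
    using that by (subst (asm) sum_nonneg_eq_0_iff) auto
  then have "herm H (e j) (e j) = 0" if "j < CARD('n)" for j
    using that n by (simp add: eigenvalue)
  then show ?thesis
    using diag by (intro hermitian_diagonal_zero[OF H _ span]) (metis lessThan_iff)
qed

section \<open>Functions on Kaehler manifolds\<close>

lemma wedge_zero_left: "wedge p q (\<lambda>X. 0) b = (\<lambda>X. 0)"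
  by (simp add: wedge_def)

lemma form11_zero: "form11 0 = (\<lambda>X. 0)"
  by (simp add: form11_def)

text \<open>
  The coordinate expression of \<open>v\<close> is differentiated on this set, so it must be open.
\<close>

lemma (in complex_manifold) open_chart_image:
  assumes "c \<in> \<A>" "openin M \<Omega>"
  shows "open (snd c ` (fst c \<inter> \<Omega>))"
proof -
  have "openin (subtopology M (fst c)) (fst c \<inter> \<Omega>)"
    using assms by (auto simp: openin_subtopology)
  moreover have "open_map (subtopology M (fst c)) (top_of_set (snd c ` fst c)) (snd c)"
    using chart_homeo[OF assms(1)] homeomorphic_imp_open_map by blast
  ultimately have "openin (top_of_set (snd c ` fst c)) (snd c ` (fst c \<inter> \<Omega>))"
    by (auto simp: open_map_def)
  then show ?thesis using chart_image[OF assms(1)] by (simp add: openin_open_eq)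
qed

lemma (in kaehler_manifold) kaehler_form_positive:
  assumes "c \<in> \<A>" "z \<in> snd c ` fst c"
  obtains G where "positive_definite G" "\<omega> c z = form11 G"
proof -
  obtain g where "\<forall>k l. g z $ l $ k = cnj (g z $ k $ l)"
    "\<forall>x. x \<noteq> 0 \<longrightarrow> Re (\<Sum>k\<in>UNIV. \<Sum>l\<in>UNIV. g z $ k $ l * x $ k * cnj (x $ l)) > 0"
    "\<omega> c z = form11 (g z)"
    using hermitian_metric[OF assms(1)] assms(2) by blast
  then show thesis
    using that unfolding positive_definite_def hermitian_def herm_def by blast
qed

theorem corollary3p3:
  fixes M :: "'m topology"
    and \<A> :: "('m, 'n::finite) chart set"
    and \<omega> :: "('m, 'n) chart \<Rightarrow> complex^'n \<Rightarrow> 'n form"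
    and \<Omega> :: "'m set"
    and v :: "'m \<Rightarrow> real"
  assumes "kaehler_manifold M \<A> \<omega>"
    and "CARD('n) \<ge> 2"
    and "openin M \<Omega>" and "connectedin M \<Omega>" and "\<Omega> \<noteq> {}"
    and "C_k_function 2 \<A> \<Omega> v"
  shows "m_harmonic 2 \<A> \<omega> \<Omega> v \<longleftrightarrow> pluriharmonic \<A> \<Omega> v"
proof
  interpret kaehler_manifold M \<A> \<omega> by fact
  obtain m where m: "CARD('n) = m + 2"
    using assms(2) by (metis add.commute le_Suc_ex)
  assume harmonic: "m_harmonic 2 \<A> \<omega> \<Omega> v"
  show "pluriharmonic \<A> \<Omega> v"
    unfolding pluriharmonic_def vanishes_on_def
  proof (intro ballI)
    fix c z assume c: "c \<in> \<A>" and z: "z \<in> snd c ` (fst c \<inter> \<Omega>)"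
    let ?H = "complex_hessian (\<lambda>z. v (chart_inv c z)) z"
    have ddc: "ddc v c z = form11 ?H"
      by (simp add: ddc_def ddc_coord_def complex_hessian_def)
    obtain G where G: "positive_definite G" "\<omega> c z = form11 G"
      using kaehler_form_positive[OF c, of z] z by blast
    have "hermitian ?H"
      using assms(6) c z unfolding C_k_function_def
      by (intro hermitian_complex_hessian[OF open_chart_image[OF c assms(3)]]) auto
    moreover have wedges: "wedge (k * 2) ((CARD('n) - k) * 2) (wedge_power 2 (form11 ?H) k)
        (wedge_power 2 (form11 G) (CARD('n) - k)) = (\<lambda>X. 0)" if "k \<in> {1..2}" for k
      using harmonic that c z unfolding m_harmonic_def vanishes_on_def by (metis ddc G(2))
    have "wedge_power 2 (form11 ?H) 1 = form11 ?H"
      using wedge_form11_one by simp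
    then have "wedge 2 (2 * Suc m) (form11 ?H) (wedge_power 2 (form11 G) (Suc m)) = (\<lambda>X. 0)"
      using wedges[of 1] by (simp add: m mult.commute del: wedge_power.simps)
    moreover have "wedge 4 (2 * m) (wedge_power 2 (form11 ?H) 2) (wedge_power 2 (form11 G) m) = (\<lambda>X. 0)"
      using wedges[of 2] by (simp add: m mult.commute del: wedge_power.simps)
    ultimately have "?H = 0"
      using hermitian_zero_if_wedges_vanish[OF G(1) _ m] by blast
    then show "ddc v c z = (\<lambda>X. 0)" by (simp add: ddc form11_zero)
  qed
next
  assume "pluriharmonic \<A> \<Omega> v"
  then have "ddc v c z = (\<lambda>X. 0)" if "c \<in> \<A>" "z \<in> snd c ` (fst c \<inter> \<Omega>)" for c z
    using that unfolding pluriharmonic_def vanishes_on_def by blast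
  moreover have "wedge_power 2 (\<lambda>X. 0 :: complex) k = ((\<lambda>X. 0) :: 'n form)" if "k \<ge> 1" for k
    using that by (cases k) (simp_all add: wedge_zero_left)
  ultimately show "m_harmonic 2 \<A> \<omega> \<Omega> v"
    unfolding m_harmonic_def vanishes_on_def by (simp add: wedge_zero_left)
qed

end
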